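(* Let $n$ be an even positive integer and let $k$ be an integer with $2\le k\le n-2$. Then $F_{\mathrm{inv}}$ over $\mathbb F_{2^n}$ is not $k$th order sum-free.
   Context: $F_{\mathrm{inv}}:\mathbb F_{2^n}\to\mathbb F_{2^n}$ is defined by $F_{\mathrm{inv}}(x)=x^{2^n-2}$ (so $F_{\mathrm{inv}}(x)=x^{-1}$ for $x\ne0$ and $F_{\mathrm{inv}}(0)=0$). For an integer $1\le k\le n-1$, a function $F:\mathbb F_{2^n}\to\mathbb F_{2^n}$ is called $k$th order sum-free if $\sum_{x\in A}F(x)\ne 0$ for every $k$-dimensional affine $\mathbb F_2$-subspace $A$ of $\mathbb F_{2^n}$. *)

theory Defs
  imports Complex_Main "HOL-Library.Z2" "HOL-Library.Cardinality" "HOL-Number_Theory.Number_Theory"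
begin

text \<open>
  The field with \<open>2 ^ n\<close> elements is rendered as a type of class \<open>{field, finite}\<close> of cardinality
  \<open>2 ^ n\<close>, and the prime field is the type \<open>bit\<close>. The function below is the action of the prime
  field; it satisfies the vector space axioms precisely when the characteristic of \<open>'a\<close> is 2
  (for fields of cardinality \<open>2 ^ n\<close>, see \<open>vector_space_scaleF2\<close>).
\<close>

definition scaleF2 :: "bit \<Rightarrow> 'a::field \<Rightarrow> 'a"
  where "scaleF2 c x = (if c = 0 then 0 else x)"

definition affine_F2_subspace :: "nat \<Rightarrow> 'a::field set \<Rightarrow> bool"
  where "affine_F2_subspace k A \<longleftrightarrow>
    (\<exists>a V. module.subspace scaleF2 V \<and> vector_space.dim scaleF2 V = k \<and> A = (\<lambda>v. a + v) ` V)"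

definition kth_order_sum_free :: "nat \<Rightarrow> ('a::{field, finite} \<Rightarrow> 'a) \<Rightarrow> bool"
  where "kth_order_sum_free k F \<longleftrightarrow> (\<forall>A. affine_F2_subspace k A \<longrightarrow> (\<Sum>x\<in>A. F x) \<noteq> 0)"

definition F_inv :: "nat \<Rightarrow> 'a::field \<Rightarrow> 'a"
  where "F_inv n x = x ^ (2 ^ n - 2)"

lemma two_eq_zero_of_card:
  assumes "CARD('a::{field, finite}) = 2 ^ n"
  shows "(1 + 1 :: 'a) = 0"
proof -
  have "prime CHAR('a)"
    by (intro prime_CHAR_semidom finite_imp_CHAR_pos) simp
  moreover have "CHAR('a) dvd 2 ^ n"
    using CHAR_dvd_CARD[where 'a = 'a] assms by simp
  ultimately have "CHAR('a) = 2"
    by (metis prime_dvd_power primes_dvd_imp_eq two_is_prime_nat)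
  then show ?thesis
    by (metis of_nat_CHAR of_nat_numeral one_add_one)
qed

lemma vector_space_scaleF2:
  assumes "CARD('a::{field, finite}) = 2 ^ n"
  shows "vector_space (scaleF2 :: bit \<Rightarrow> 'a \<Rightarrow> 'a)"
proof -
  have "x + x = 0" for x :: 'a
    using two_eq_zero_of_card[OF assms] by (metis distrib_left mult.right_neutral mult_zero_right)
  then show ?thesis
    by unfold_locales (auto simp: scaleF2_def)
qed

end

theory Submission
  imports Defs "HOL-Computational_Algebra.Polynomial"
begin

text \<open>
  It suffices to find an additive subgroup \<open>U\<close> with \<open>2 ^ k\<close> elements whose nonzero elements have
  inverses summing to \<open>0\<close>. Let \<open>n = 2 m\<close> and \<open>f z = z ^ 4 + z\<close>, an \<open>F\<^sub>4\<close>-linear map with kernel \<open>F\<^sub>4\<close>.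
  The inverses over a fibre of \<open>f\<close> above \<open>y \<noteq> 0\<close> sum to the inverse of \<open>y\<close>, and over \<open>F\<^sub>4\<close> they sum
  to \<open>0\<close>; so if \<open>U\<close> lies in the range of \<open>f\<close>, its preimage is again a zero-sum subgroup, of dimension
  two larger. The range of \<open>f\<close> is the kernel of the trace to \<open>F\<^sub>4\<close>, so by a pigeonhole argument every
  \<open>U\<close> whose \<open>F\<^sub>4\<close>-span has dimension less than \<open>m\<close> can be scaled into that range.

  For even \<open>k\<close> one starts from \<open>{0}\<close>. For odd \<open>k\<close> one starts from a three-dimensional zero-sum
  subgroup. Take \<open>t\<close> in the subfield with \<open>2 ^ m\<close> elements but not in \<open>F\<^sub>4\<close>, and put
  \<open>u = 1 + 1 / (t\<^sup>2 + t)\<close> and \<open>v = t u\<close>, so that \<open>1 / u + 1 / v + 1 / (u + v) = 1\<close>. Elements of the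
  subfield have absolute trace \<open>0\<close>, hence \<open>u\<close> and \<open>v\<close> are of the form \<open>z\<^sup>2 + z\<close>, and the preimage of
  \<open>{0, u, v, u + v}\<close> under \<open>z \<mapsto> z\<^sup>2 + z\<close> is as required.
\<close>

section \<open>Characteristic 2, finite fields, and fibres of additive maps\<close>

lemma char2_add_self:
  fixes x :: "'a::field"
  assumes "CHAR('a) = 2"
  shows "x + x = 0" "x + (x + y) = y" "(2 :: 'a) = 0"
proof -
  show x: "x + x = 0"
    using add.right_inverse[of x] by (simp only: uminus_CHAR_2[OF assms])
  show "x + (x + y) = y"
    by (simp only: add.assoc[symmetric] x add_0_left)
  show "(2 :: 'a) = 0"
    using of_nat_CHAR[where 'a = 'a] by (simp add: assms)
qed

lemma char2_add_eq_0_iff: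
  fixes x :: "'a::field"
  assumes "CHAR('a) = 2"
  shows "x + y = 0 \<longleftrightarrow> x = y"
  by (simp add: add_eq_0_iff2 uminus_CHAR_2[OF assms])

lemma char2_power_add:
  fixes x :: "'a::field"
  assumes "CHAR('a) = 2"
  shows "(x + y) ^ (2 ^ s) = x ^ (2 ^ s) + y ^ (2 ^ s)"
  by (rule freshmans_dream'[where n = s]) (simp_all add: assms)

lemma char2_power_sum:
  fixes f :: "'b \<Rightarrow> 'a::field"
  assumes "CHAR('a) = 2"
  shows "(\<Sum>i\<in>A. f i) ^ (2 ^ s) = (\<Sum>i\<in>A. f i ^ (2 ^ s))"
  by (rule freshmans_dream_sum'[where n = s]) (simp_all add: assms)

text \<open>Multiplication by a nonzero \<open>x\<close> permutes the nonzero elements, so their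
  product absorbs the factor \<open>x ^ (CARD('a) - 1)\<close>.\<close>

lemma finite_field_power_card:
  fixes x :: "'a::{field, finite}"
  shows "x ^ CARD('a) = x"
proof (cases "x = 0")
  case False
  let ?P = "\<Prod>(UNIV - {0 :: 'a})"
  have "bij_betw ((*) x) (UNIV - {0}) (UNIV - {0})"
    using False by (intro bij_betwI[where g = "\<lambda>y. y / x"]) auto
  then have "(\<Prod>y\<in>UNIV - {0}. x * y) = ?P"
    by (rule prod.reindex_bij_betw)
  then have "x ^ (CARD('a) - 1) * ?P = ?P"
    by (simp add: prod.distrib card_Diff_singleton)
  moreover have "?P \<noteq> 0"
    by simp
  ultimately have "x ^ (CARD('a) - 1) = 1"
    by simp
  then have "x ^ (CARD('a) - 1) * x = x"
    by (simp only: mult_1_left)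
  then show ?thesis
    by (simp only: power_minus_mult[OF zero_less_card_finite])
qed (simp add: zero_power)

text \<open>Every fibre over a point of the range is a coset of the kernel.\<close>

lemma card_vimage_additive:
  fixes f :: "'a::{ab_group_add, finite} \<Rightarrow> 'b::ab_group_add"
  assumes add: "\<And>x y. f (x + y) = f x + f y" and sub: "U \<subseteq> range f"
  shows "card (f -` U) = card (f -` {0}) * card U"
proof -
  have "finite U"
    using finite_subset[OF sub] by simp
  have d: "f (x - y) = f x - f y" for x y
    using add[of "x - y" y] by simp
  have "card (f -` {y}) = card (f -` {0})" if y: "y \<in> U" for y
  proof -
    obtain x where x: "y = f x"
      using sub y by auto
    have "x' \<in> (+) x ` (f -` {0})" if "f x' = f x" for x'
      using that by (intro image_eqI[where x = "x' - x"]) (simp_all add: d)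
    then have "f -` {y} = (+) x ` (f -` {0})"
      by (auto simp: add x)
    then show ?thesis
      by (simp add: card_image)
  qed
  moreover have "card (f -` U) = (\<Sum>y\<in>U. card (f -` {y}))"
  proof -
    have "f -` U = (\<Union>y\<in>U. f -` {y})" by auto
    then show ?thesis
      using \<open>finite U\<close> by (simp only:, intro card_UN_disjoint) auto
  qed
  ultimately show ?thesis
    by simp
qed

text \<open>Serves both \<open>z\<^sup>2 + z\<close> and \<open>z ^ 4 + z\<close>. The kernel term
  stays separate because it is 1 for the first map and 0 for the second.\<close>

lemma sum_inverse_vimage:
  fixes f :: "'a::{field, finite} \<Rightarrow> 'a"
  assumes "U \<subseteq> range f" and "0 \<in> U"
    and fiber: "\<And>x. f x \<noteq> 0 \<Longrightarrow> (\<Sum>y\<in>f -` {f x}. inverse y) = inverse (f x)"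
  shows "(\<Sum>x\<in>f -` U. inverse x) = (\<Sum>x\<in>f -` {0}. inverse x) + (\<Sum>u\<in>U. inverse u)"
proof -
  have "(\<Sum>x\<in>f -` U. inverse x) = (\<Sum>u\<in>U. \<Sum>x\<in>f -` {u}. inverse x)"
    by (subst sum.UNION_disjoint[symmetric]) (auto intro!: sum.cong)
  also have "\<dots> = (\<Sum>x\<in>f -` {0}. inverse x) + (\<Sum>u\<in>U - {0}. \<Sum>x\<in>f -` {u}. inverse x)"
    using \<open>0 \<in> U\<close> by (subst sum.remove[of _ 0]) auto
  also have "(\<Sum>u\<in>U - {0}. \<Sum>x\<in>f -` {u}. inverse x) = (\<Sum>u\<in>U - {0}. inverse u)"
    using assms by (intro sum.cong refl) (auto intro: fiber)
  also have "\<dots> = (\<Sum>u\<in>U. inverse u)"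
    by (rule sum.mono_neutral_left) auto
  finally show ?thesis .
qed

lemma card_fixed_power_le:
  fixes p :: nat
  assumes "1 < p"
  shows "card {c :: 'a::field. c ^ p = c} \<le> p"
proof -
  let ?P = "monom 1 p - monom 1 1 :: 'a poly"
  have "coeff ?P p = 1" "degree ?P \<le> p"
    using assms by (auto intro!: degree_diff_le degree_monom_le order.trans[OF degree_monom_le])
  moreover from this(1) have "?P \<noteq> 0" by (metis coeff_0 zero_neq_one)
  moreover have "{c. c ^ p = c} = {c. poly ?P c = 0}"
    by (auto simp: poly_monom)
  ultimately show ?thesis
    using card_poly_roots_bound[of ?P] by simp
qed

section \<open>Relative traces and the ranges of Artin-Schreier maps\<close>

text \<open>In a field with \<open>2 ^ (s * m)\<close> elements this is the trace to the subfield
  with \<open>2 ^ s\<close> elements.\<close>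

definition rel_trace :: "nat \<Rightarrow> nat \<Rightarrow> 'a::field \<Rightarrow> 'a"
  where "rel_trace s m x = (\<Sum>i<m. x ^ (2 ^ (s * i)))"

lemma rel_trace_add:
  fixes x y :: "'a::field"
  assumes "CHAR('a) = 2"
  shows "rel_trace s m (x + y) = rel_trace s m x + rel_trace s m y"
  by (simp add: rel_trace_def char2_power_add[OF assms] sum.distrib)

text \<open>Raising to the power \<open>2 ^ s\<close> shifts the summands cyclically; the last one
  wraps around to \<open>x\<close> because \<open>x ^ CARD('a) = x\<close>.\<close>

lemma rel_trace_power:
  fixes x :: "'a::{field, finite}"
  assumes "CHAR('a) = 2" and "CARD('a) = 2 ^ (s * m)" and "0 < m"
  shows "rel_trace s m x ^ 2 ^ s = rel_trace s m x"
proof -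
  obtain m' where m: "m = Suc m'" using \<open>0 < m\<close> gr0_implies_Suc by blast
  have "rel_trace s m x ^ 2 ^ s = (\<Sum>i<m. x ^ (2 ^ (s * Suc i)))"
    by (simp add: rel_trace_def char2_power_sum[OF assms(1)] power_mult[symmetric] power_add mult.commute)
  also have "\<dots> = (\<Sum>i<m'. x ^ (2 ^ (s * Suc i))) + x ^ (2 ^ (s * 0))"
    using finite_field_power_card[of x] by (simp add: m assms(2))
  also have "\<dots> = rel_trace s m x"
    unfolding rel_trace_def m by (subst sum.lessThan_Suc_shift) (simp add: add.commute)
  finally show ?thesis .
qed

lemma rel_trace_of_power:
  fixes x :: "'a::field"
  assumes "CHAR('a) = 2"
  shows "rel_trace s m (x ^ 2 ^ s) = rel_trace s m x ^ 2 ^ s"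
  by (simp add: rel_trace_def char2_power_sum[OF assms] power_mult[symmetric] mult.commute)

lemma card_rel_trace_eq_0_le:
  assumes "0 < s" and "0 < m"
  shows "card {x :: 'a::field. rel_trace s m x = 0} \<le> 2 ^ (s * (m - 1))"
proof -
  let ?P = "\<Sum>i<m. monom 1 (2 ^ (s * i)) :: 'a poly"
  have "coeff ?P (2 ^ (s * (m - 1))) = (\<Sum>i<m. if i = m - 1 then 1 else 0)"
    unfolding coeff_sum using \<open>0 < s\<close> by (intro sum.cong) auto
  also have "\<dots> = 1"
    using \<open>0 < m\<close> by simp
  finally have "?P \<noteq> 0"
    by auto
  moreover have "degree ?P \<le> 2 ^ (s * (m - 1))"
    by (intro degree_sum_le) (auto intro!: order.trans[OF degree_monom_le] power_increasing mult_le_mono)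
  moreover have "{x. rel_trace s m x = 0} = {x. poly ?P x = 0}"
    by (auto simp: rel_trace_def poly_sum poly_monom)
  ultimately show ?thesis
    using card_poly_roots_bound[of ?P] by simp
qed

text \<open>Kernel and range of \<open>z ^ 2 ^ s + z\<close> have sizes with product
  \<open>2 ^ (s * m)\<close>. Counting roots bounds the kernel by \<open>2 ^ s\<close>, and the
  range, lying in the trace kernel, by \<open>2 ^ (s * (m - 1))\<close>; hence both bounds are
  attained.\<close>

lemma
  assumes two: "CHAR('a::{field, finite}) = 2"
    and card: "CARD('a) = 2 ^ (s * m)" and "0 < s" and "0 < m"
  shows range_artin_schreier: "range (\<lambda>z :: 'a. z ^ 2 ^ s + z) = {x. rel_trace s m x = 0}"
    and card_fixed_power: "card {c :: 'a. c ^ 2 ^ s = c} = 2 ^ s"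
proof -
  let ?f = "\<lambda>z :: 'a. z ^ 2 ^ s + z" and ?F = "{c :: 'a. c ^ 2 ^ s = c}"
    and ?K = "{x :: 'a. rel_trace s m x = 0}"
  obtain m' where m: "m = Suc m'" using \<open>0 < m\<close> gr0_implies_Suc by blast
  have f0: "?f -` {0} = ?F"
    by (simp add: vimage_def char2_add_eq_0_iff[OF two])
  have "card (?f -` range ?f) = card (?f -` {0}) * card (range ?f)"
    by (rule card_vimage_additive) (simp_all add: char2_power_add[OF two])
  moreover have "?f -` range ?f = UNIV" by auto
  ultimately have prod: "card ?F * card (range ?f) = 2 ^ s * 2 ^ (s * m')"
    using card by (simp only: f0 m mult_Suc_right power_add)
  have sub: "range ?f \<subseteq> ?K"
    using rel_trace_power[OF two card \<open>0 < m\<close>]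
    by (auto simp: rel_trace_add[OF two] rel_trace_of_power[OF two] char2_add_self[OF two])
  have K: "card ?K \<le> 2 ^ (s * m')"
    using card_rel_trace_eq_0_le[OF \<open>0 < s\<close> \<open>0 < m\<close>] by (simp add: m)
  have r: "card (range ?f) \<le> 2 ^ (s * m')"
    using card_mono[OF _ sub] K by simp
  have "1 < (2 :: nat) ^ s"
    using \<open>0 < s\<close> by (intro one_less_power) auto
  then have F: "card ?F \<le> 2 ^ s"
    by (rule card_fixed_power_le)
  have "2 ^ s * 2 ^ (s * m') \<le> card ?F * 2 ^ (s * m')"
    unfolding prod[symmetric] by (rule mult_le_mono2[OF r])
  then show F: "card ?F = 2 ^ s"
    using F by simp
  with prod have "card (range ?f) = 2 ^ (s * m')"
    by simp
  with K show "range ?f = ?K"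
    using card_mono[OF _ sub] by (intro card_subset_eq sub) simp_all
qed

section \<open>Sums of inverses over fibres\<close>

lemma char2_inverse_add_1:
  fixes z :: "'a::field"
  assumes "CHAR('a) = 2" and "z\<^sup>2 + z \<noteq> 0"
  shows "inverse z + inverse (z + 1) = inverse (z\<^sup>2 + z)"
proof -
  have "z * (z + 1) \<noteq> 0"
    using assms(2) by (simp add: power2_eq_square distrib_left)
  then have "z \<noteq> 0" "z + 1 \<noteq> 0"
    by auto
  then have "inverse z + inverse (z + 1) = (z + (z + 1)) * inverse (z\<^sup>2 + z)"
    by (simp add: field_simps power2_eq_square)
  then show ?thesis
    by (simp only: char2_add_self[OF assms(1)] mult_1_left)
qed

lemma char2_quadratic_eq_iff:
  fixes x y :: "'a::field"
  assumes char: "CHAR('a) = 2"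
  shows "y\<^sup>2 + y = x\<^sup>2 + x \<longleftrightarrow> y = x \<or> y = x + 1"
proof -
  have "y\<^sup>2 + y = x\<^sup>2 + x \<longleftrightarrow> (y\<^sup>2 + y) + (x\<^sup>2 + x) = 0"
    by (simp add: char2_add_eq_0_iff[OF char])
  also have "(y\<^sup>2 + y) + (x\<^sup>2 + x) = (y + x) * (y + (x + 1)) - 2 * (y * x)"
    by (simp add: algebra_simps power2_eq_square)
  also have "\<dots> = 0 \<longleftrightarrow> y = x \<or> y = x + 1"
    by (simp only: char2_add_self[OF char] mult_zero_left diff_0_right mult_eq_0_iff
        char2_add_eq_0_iff[OF char])
  finally show ?thesis .
qed

lemma sum_inverse_fiber_quadratic:
  fixes x :: "'a::field"
  assumes char: "CHAR('a) = 2" and "x\<^sup>2 + x \<noteq> 0"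
  shows "(\<Sum>y\<in>(\<lambda>z. z\<^sup>2 + z) -` {x\<^sup>2 + x}. inverse y) = inverse (x\<^sup>2 + x)"
proof -
  have "(\<lambda>z. z\<^sup>2 + z) -` {x\<^sup>2 + x} = {x, x + 1}"
    by (auto simp: char2_quadratic_eq_iff[OF char])
  then show ?thesis
    using char2_inverse_add_1[OF assms] by simp
qed

text \<open>Here \<open>w\<close> is a primitive cube root of unity. The grouping into pairs
  differing by 1 is the one to which \<open>char2_inverse_add_1\<close> applies.\<close>

lemma sum_over_F4:
  assumes char: "CHAR('a::{field, finite}) = 2" and F4: "card {c :: 'a. c ^ 4 = c} = 4"
  shows "\<exists>w :: 'a. w\<^sup>2 + w = 1 \<and>
    (\<forall>g :: 'a \<Rightarrow> 'a. (\<Sum>c\<in>{c. c ^ 4 = c}. g c) = g 0 + g 1 + (g w + g (w + 1)))"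
proof -
  let ?F = "{c :: 'a. c ^ 4 = c}"
  note two = char2_add_self[OF char]
  have p4: "(a + b) ^ 4 = a ^ 4 + b ^ 4" for a b :: 'a
    using char2_power_add[OF char, of a b 2] by simp
  have "\<not> ?F \<subseteq> {0, 1}"
    using card_mono[of "{0, 1 :: 'a}" ?F] F4 by auto
  then obtain w :: 'a where w: "w ^ 4 = w" "w \<noteq> 0" "w \<noteq> 1"
    by auto
  have "w * ((w - 1) * (w\<^sup>2 + (w + 1))) = w ^ 4 - w"
    by (simp add: algebra_simps eval_nat_numeral)
  then have w2: "w\<^sup>2 = w + 1"
    using w by (simp add: char2_add_eq_0_iff[OF char])
  have ne: "w + 1 \<noteq> 0" "w + 1 \<noteq> 1" "w + 1 \<noteq> w"
    using w by (auto simp: char2_add_eq_0_iff[OF char])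
  have "{0, 1, w, w + 1} \<subseteq> ?F"
    using w by (auto simp: p4)
  moreover have "card {0, 1, w, w + 1} = 4"
    using w ne by auto
  ultimately have F: "?F = {0, 1, w, w + 1}"
    using F4 by (metis card_subset_eq finite)
  have "(\<Sum>c\<in>?F. g c) = g 0 + g 1 + (g w + g (w + 1))" for g :: "'a \<Rightarrow> 'a"
    unfolding F using w ne by (simp add: add.assoc)
  moreover have "w\<^sup>2 + w = 1"
    by (simp only: w2 add.commute[of w 1] add.assoc two) simp
  ultimately show ?thesis
    by blast
qed

lemma sum_inverse_F4:
  assumes char: "CHAR('a::{field, finite}) = 2" and F4: "card {c :: 'a. c ^ 4 = c} = 4"
  shows "(\<Sum>c\<in>{c :: 'a. c ^ 4 = c}. inverse c) = 0"
proof -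
  obtain w :: 'a where w: "w\<^sup>2 + w = 1"
    and sum_F: "(\<Sum>c\<in>{c :: 'a. c ^ 4 = c}. inverse c) = inverse 0 + inverse 1 + (inverse w + inverse (w + 1))"
    using sum_over_F4[OF assms] by blast
  have "inverse w + inverse (w + 1) = 1"
    using char2_inverse_add_1[OF char, of w] w by simp
  then show ?thesis
    by (simp only: sum_F) (simp add: char2_add_self[OF char])
qed

text \<open>The map \<open>z ^ 4 + z\<close> is \<open>z\<^sup>2 + z\<close> applied twice, so
  \<open>char2_inverse_add_1\<close> is used at \<open>x\<close> and \<open>x + w\<close>, and then
  once more at \<open>x\<^sup>2 + x\<close>.\<close>

lemma sum_inverse_fiber_quartic:
  fixes x :: "'a::{field, finite}"
  assumes char: "CHAR('a) = 2" and F4: "card {c :: 'a. c ^ 4 = c} = 4" and nz: "x ^ 4 + x \<noteq> 0"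
  shows "(\<Sum>y\<in>(\<lambda>z. z ^ 4 + z) -` {x ^ 4 + x}. inverse y) = inverse (x ^ 4 + x)"
proof -
  let ?F = "{c :: 'a. c ^ 4 = c}"
  note two = char2_add_self[OF char]
  have p2: "(a + b)\<^sup>2 = a\<^sup>2 + b\<^sup>2" and p4: "(a + b) ^ 4 = a ^ 4 + b ^ 4" for a b :: 'a
    using char2_power_add[OF char, of a b 1] char2_power_add[OF char, of a b 2] by simp_all
  obtain w :: 'a where w: "w\<^sup>2 + w = 1"
    and sum_F: "\<And>g :: 'a \<Rightarrow> 'a. (\<Sum>c\<in>?F. g c) = g 0 + g 1 + (g w + g (w + 1))"
    using sum_over_F4[OF char F4] by blast
  have 2: "(x\<^sup>2 + x)\<^sup>2 + (x\<^sup>2 + x) = x ^ 4 + x"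
    by (simp add: p2 power_mult[symmetric] add.assoc two)
  have 1: "(x + w)\<^sup>2 + (x + w) = x\<^sup>2 + x + 1"
  proof -
    have "(x + w)\<^sup>2 + (x + w) = (x\<^sup>2 + x) + (w\<^sup>2 + w)"
      by (simp only: p2 ac_simps)
    then show ?thesis by (simp only: w)
  qed
  \<comment> \<open>The factors are the values of \<open>z\<^sup>2 + z\<close> at \<open>x\<close>
    and \<open>x + w\<close>; both must be nonzero for the pairwise sums.\<close>
  have "(x\<^sup>2 + x) * (x\<^sup>2 + x + 1) = x ^ 4 + x"
    unfolding 2[symmetric] by (simp add: power2_eq_square algebra_simps)
  then have 3: "x\<^sup>2 + x \<noteq> 0" "x\<^sup>2 + x + 1 \<noteq> 0"
    using nz by (metis mult_zero_left, metis mult_zero_right)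
  have "(\<lambda>z. z ^ 4 + z) -` {x ^ 4 + x} = (+) x ` ?F"
  proof (intro equalityI subsetI)
    fix y assume "y \<in> (\<lambda>z. z ^ 4 + z) -` {x ^ 4 + x}"
    then have "(y ^ 4 + y) + (x ^ 4 + x) = 0"
      by (simp add: char2_add_self[OF char])
    then have "(x ^ 4 + y ^ 4) + (x + y) = 0"
      by (simp only: ac_simps)
    then have "x + y \<in> ?F"
      by (simp only: p4[symmetric] char2_add_eq_0_iff[OF char] mem_Collect_eq)
    then show "y \<in> (+) x ` ?F"
      by (metis image_eqI two(2))
  next
    fix y assume "y \<in> (+) x ` ?F"
    then obtain c where "c ^ 4 = c" "y = x + c"
      by auto
    then have "y ^ 4 + y = c + (c + (x ^ 4 + x))"
      by (simp only: p4 ac_simps)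
    then show "y \<in> (\<lambda>z. z ^ 4 + z) -` {x ^ 4 + x}"
      by (simp add: two)
  qed
  then have "(\<Sum>y\<in>(\<lambda>z. z ^ 4 + z) -` {x ^ 4 + x}. inverse y) = (\<Sum>c\<in>?F. inverse (x + c))"
    by (simp add: sum.reindex)
  also have "\<dots> = (inverse x + inverse (x + 1)) + (inverse (x + w) + inverse ((x + w) + 1))"
    by (simp only: sum_F add_0_right add.assoc)
  also have "\<dots> = inverse (x\<^sup>2 + x) + inverse (x\<^sup>2 + x + 1)"
    by (simp only: char2_inverse_add_1[OF char 3(1)]
        char2_inverse_add_1[OF char, of "x + w", unfolded 1, OF 3(2)])
  also have "\<dots> = inverse (x ^ 4 + x)"
    by (rule char2_inverse_add_1[OF char, of "x\<^sup>2 + x", unfolded 2, OF nz])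
  finally show "(\<Sum>y\<in>(\<lambda>z. z ^ 4 + z) -` {x ^ 4 + x}. inverse y) = inverse (x ^ 4 + x)" .
qed

section \<open>Spans over \<open>F\<^sub>4\<close> and scaling into the range\<close>

text \<open>The equation \<open>c ^ 4 = c\<close> stands for a scalar in \<open>F\<^sub>4\<close>,
  so no separate scalar type is needed.\<close>

inductive_set F4_span :: "'a::field set \<Rightarrow> 'a set" for B where
  zero: "0 \<in> F4_span B"
| add: "x \<in> F4_span B \<Longrightarrow> b \<in> B \<Longrightarrow> c ^ 4 = c \<Longrightarrow> x + c * b \<in> F4_span B"

lemma F4_span_mono:
  assumes "B \<subseteq> C"
  shows "F4_span B \<subseteq> F4_span C"
proof
  fix x assume "x \<in> F4_span B"
  then show "x \<in> F4_span C"
    using assms by induction (auto intro: F4_span.intros)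
qed

lemma F4_span_scale:
  assumes "x \<in> F4_span B"
  shows "a * x \<in> F4_span ((*) a ` B)"
  using assms
proof induction
  case (add x b c)
  then have "a * x + c * (a * b) \<in> F4_span ((*) a ` B)"
    by (intro F4_span.add) auto
  then show ?case
    by (simp add: algebra_simps)
qed (simp add: F4_span.zero)

text \<open>Preimages of the generators suffice because \<open>z ^ 4 + z\<close> is
  \<open>F\<^sub>4\<close>-linear.\<close>

lemma F4_span_lift:
  fixes B :: "'a::{field, finite} set"
  assumes char: "CHAR('a) = 2" and lift: "\<And>b. b \<in> B \<Longrightarrow> g b ^ 4 + g b = b"
    and x: "x \<in> F4_span B"
  shows "\<exists>y\<in>F4_span (g ` B). y ^ 4 + y = x"
  using x
proof induction
  case (add x b c)
  then obtain y where "y \<in> F4_span (g ` B)" "y ^ 4 + y = x"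
    by blast
  moreover have "(y + c * g b) ^ 4 = y ^ 4 + c * g b ^ 4"
    using char2_power_add[OF char, of y _ 2] add by (simp add: power_mult_distrib)
  then have "(y + c * g b) ^ 4 + (y + c * g b) = (y ^ 4 + y) + c * (g b ^ 4 + g b)"
    by (simp add: algebra_simps)
  ultimately show ?case
    using add lift by (intro bexI[of _ "y + c * g b"]) (auto intro: F4_span.add)
next
  case zero
  then show ?case
    by (intro bexI[of _ 0]) (simp_all add: F4_span.zero)
qed

text \<open>The traces of the \<open>a * b\<close> with \<open>b\<close> in \<open>B\<close> form at
  most \<open>4 ^ card B < 4 ^ m\<close> patterns, so two distinct \<open>a\<close> share one. Their
  sum is nonzero and has only zero traces, which characterizes the range.\<close>

lemma exists_scale_into_range:
  fixes B :: "'a::{field, finite} set"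
  assumes char: "CHAR('a) = 2" and card: "CARD('a) = 2 ^ (2 * m)" and "card B < m"
  shows "\<exists>a. a \<noteq> 0 \<and> (\<forall>b\<in>B. a * b \<in> range (\<lambda>z. z ^ 4 + z))"
proof -
  let ?F = "{c :: 'a. c ^ 4 = c}"
  let ?h = "\<lambda>a. \<lambda>b\<in>B. rel_trace 2 m (a * b)"
  have "m > 0" using assms(3) by simp
  have "range ?h \<subseteq> B \<rightarrow>\<^sub>E ?F"
    using rel_trace_power[OF char card \<open>m > 0\<close>] by auto
  then have "card (range ?h) \<le> card (B \<rightarrow>\<^sub>E ?F)"
    by (intro card_mono finite_PiE) auto
  also have "\<dots> = 4 ^ card B"
    using card_fixed_power[OF char card _ \<open>m > 0\<close>] by (simp add: card_PiE)
  also have "\<dots> < 4 ^ m"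
    using assms(3) by simp
  also have "\<dots> = CARD('a)"
    by (simp add: card power_mult)
  finally have "\<not> inj ?h"
    using card_image by fastforce
  then obtain a a' where a: "a \<noteq> a'" "?h a = ?h a'"
    by (auto simp: inj_def)
  have "rel_trace 2 m ((a + a') * b) = 0" if "b \<in> B" for b
    using fun_cong[OF a(2), of b] that
    by (simp add: distrib_right rel_trace_add[OF char] char2_add_self[OF char])
  then have "\<forall>b\<in>B. (a + a') * b \<in> range (\<lambda>z. z ^ 4 + z)"
    using range_artin_schreier[OF char card _ \<open>m > 0\<close>] by simp
  moreover have "a + a' \<noteq> 0"
    using a by (simp add: char2_add_eq_0_iff[OF char])
  ultimately show ?thesis by blast
qed

section \<open>From zero-sum subgroups to failure of sum-freeness\<close>

text \<open>Adjoining an independent vector \<open>b\<close> doubles the span, by a disjoint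
  translate, so a basis of \<open>d\<close> vectors spans \<open>2 ^ d\<close> elements.\<close>

lemma dim_scaleF2:
  fixes V :: "'a::{field, finite} set"
  assumes CARD: "CARD('a) = 2 ^ n" and V: "module.subspace scaleF2 V" and card: "card V = 2 ^ k"
  shows "vector_space.dim scaleF2 V = k"
proof -
  interpret F2: vector_space "scaleF2 :: bit \<Rightarrow> 'a \<Rightarrow> 'a"
    by (rule vector_space_scaleF2[OF CARD])
  have "card (F2.span B) = 2 ^ card B" if "F2.independent B" for B
    using finite[of B] that
  proof (induction B rule: finite_induct)
    case (insert b B)
    then have b: "b \<notin> F2.span B" and B: "F2.independent B"
      by (auto simp: F2.independent_insert)
    have "F2.span (insert b B) = F2.span B \<union> (+) b ` F2.span B"
    proof -
      have "x \<in> F2.span (insert b B) \<longleftrightarrow> x \<in> F2.span B \<or> x - b \<in> F2.span B" for x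
        unfolding F2.span_breakdown_eq by (metis (full_types) bit_not_zero_iff diff_zero scaleF2_def zero_neq_one)
      moreover have "x - b \<in> F2.span B \<longleftrightarrow> x \<in> (+) b ` F2.span B" for x
        by (auto intro!: image_eqI[where x = "x - b"])
      ultimately show ?thesis by blast
    qed
    moreover have "F2.span B \<inter> (+) b ` F2.span B = {}"
      using b by (auto simp: F2.span_add_eq2)
    ultimately show ?case
      using insert B by (simp add: card_Un_disjoint card_image)
  qed simp
  moreover obtain B where "B \<subseteq> V" "F2.independent B" "V \<subseteq> F2.span B" "card B = F2.dim V"
    using F2.basis_exists by blast
  moreover from this have "F2.span B = V"
    using F2.span_minimal[OF _ V] by blast
  ultimately have "(2 :: nat) ^ F2.dim V = 2 ^ k"
    using card by metis
  then show ?thesis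
    by simp
qed

lemma not_sum_free_of_zero_sum:
  fixes U :: "'a::{field, finite} set"
  assumes CARD: "CARD('a) = 2 ^ n" and "n > 1"
    and U: "0 \<in> U" "\<And>x y. x \<in> U \<Longrightarrow> y \<in> U \<Longrightarrow> x + y \<in> U" "card U = 2 ^ k"
    and sum: "(\<Sum>x\<in>U. inverse x) = 0"
  shows "\<not> kth_order_sum_free k (F_inv n :: 'a \<Rightarrow> 'a)"
proof -
  interpret F2: vector_space "scaleF2 :: bit \<Rightarrow> 'a \<Rightarrow> 'a"
    by (rule vector_space_scaleF2[OF CARD])
  have "F2.subspace U"
    using U by (auto simp: F2.subspace_def scaleF2_def)
  then have affine: "affine_F2_subspace k U"
    using dim_scaleF2[OF CARD _ U(3)] unfolding affine_F2_subspace_def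
    by (intro exI[of _ 0] exI[of _ U]) auto
  \<comment> \<open>This makes the exponent \<open>2 ^ n - 2\<close> positive, so
    \<open>F_inv n\<close> sends 0 to 0 as \<open>inverse\<close> does; \<open>n = 1\<close> would
    give \<open>0 ^ 0 = 1\<close>.\<close>
  have n: "(2 :: nat) ^ 1 < 2 ^ n"
    using \<open>n > 1\<close> by (intro power_strict_increasing) auto
  have "F_inv n x = inverse x" for x :: 'a
  proof (cases "x = 0")
    case True
    with n show ?thesis
      by (simp add: F_inv_def zero_power)
  next
    case False
    have "(2 :: nat) ^ n - 2 + 2 = 2 ^ n"
      using n by simp
    then have "x ^ (2 ^ n - 2) * x\<^sup>2 = x ^ 2 ^ n"
      by (metis power_add)
    then have "x ^ (2 ^ n - 2) * x * x = x"
      using finite_field_power_card[of x] by (simp add: CARD power2_eq_square mult.assoc)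
    with False show ?thesis
      by (simp add: F_inv_def field_simps)
  qed
  with affine show ?thesis
    using sum by (auto simp: kth_order_sum_free_def)
qed

section \<open>Raising the dimension by two\<close>

text \<open>
  The subgroup \<open>U\<close> has dimension \<open>k\<close> over the prime field, while \<open>j\<close> only bounds the dimension of its
  \<open>F\<^sub>4\<close>-span. The convention \<open>inverse 0 = 0\<close> lets the sum range over all of \<open>U\<close>.
\<close>

definition F4_spanned_zero_sum :: "nat \<Rightarrow> nat \<Rightarrow> 'a::{field, finite} set \<Rightarrow> bool"
  where "F4_spanned_zero_sum k j U \<longleftrightarrow>
    0 \<in> U \<and> (\<forall>x\<in>U. \<forall>y\<in>U. x + y \<in> U) \<and> card U = 2 ^ k \<and> (\<Sum>x\<in>U. inverse x) = 0 \<and>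
    (\<exists>B. card B \<le> j \<and> U \<subseteq> F4_span B)"

text \<open>As \<open>j < m\<close>, the generators and hence \<open>U\<close> can be scaled into
  the range of \<open>z ^ 4 + z\<close>, which only multiplies the inverse sum by a constant. The
  preimage gains the kernel \<open>F\<^sub>4\<close>: two dimensions over the prime field, but just
  one more generator over \<open>F\<^sub>4\<close>.\<close>

lemma F4_spanned_zero_sum_step:
  fixes U :: "'a::{field, finite} set"
  assumes char: "CHAR('a) = 2" and card: "CARD('a) = 2 ^ (2 * m)"
    and U: "F4_spanned_zero_sum k j U" and "j < m"
  shows "\<exists>U' :: 'a set. F4_spanned_zero_sum (k + 2) (j + 1) U'"
proof -
  let ?f = "\<lambda>z :: 'a. z ^ 4 + z"
  have f_add: "?f (x + y) = ?f x + ?f y" for x y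
    using char2_power_add[OF char, of x y 2] by simp
  have F4: "card {c :: 'a. c ^ 4 = c} = 4"
    using card_fixed_power[OF char card] \<open>j < m\<close> by simp
  have ker: "?f -` {0} = {c. c ^ 4 = c}"
    by (simp add: vimage_def char2_add_eq_0_iff[OF char])
  obtain B where B: "card B \<le> j" "U \<subseteq> F4_span B"
    using U by (auto simp: F4_spanned_zero_sum_def)
  obtain a where a: "a \<noteq> 0" "\<And>b. b \<in> B \<Longrightarrow> a * b \<in> range ?f"
    using exists_scale_into_range[OF char card, of B] B \<open>j < m\<close> by auto
  define g where "g = inv_into UNIV ?f"
  have g: "g b ^ 4 + g b = b" if "b \<in> (*) a ` B" for b
    using a(2) that f_inv_into_f[of b ?f UNIV] by (auto simp: g_def)
  define U1 where "U1 = (*) a ` U"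
  have lift: "\<exists>y\<in>F4_span (g ` (*) a ` B). ?f y = x" if "x \<in> U1" for x
    using that B(2) by (intro F4_span_lift[OF char g]) (auto simp: U1_def intro: F4_span_scale)
  have U1: "0 \<in> U1" "\<And>x y. x \<in> U1 \<Longrightarrow> y \<in> U1 \<Longrightarrow> x + y \<in> U1" "card U1 = 2 ^ k"
    using U a(1) by (auto simp: F4_spanned_zero_sum_def U1_def card_image inj_on_def
        simp flip: distrib_left)
  have "(\<Sum>x\<in>U1. inverse x) = (\<Sum>x\<in>U. inverse (a * x))"
    unfolding U1_def using a(1) by (subst sum.reindex) (auto simp: inj_on_def)
  also have "\<dots> = inverse a * (\<Sum>x\<in>U. inverse x)"
    by (simp add: sum_distrib_left)
  finally have sum_U1: "(\<Sum>x\<in>U1. inverse x) = 0"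
    using U by (simp add: F4_spanned_zero_sum_def)
  have range: "U1 \<subseteq> range ?f"
    using lift by blast
  define U' where "U' = ?f -` U1"
  \<comment> \<open>The extra generator 1 spans the kernel.\<close>
  let ?B = "insert 1 (g ` (*) a ` B)"
  have "card ?B \<le> Suc (card (g ` (*) a ` B))"
    by (rule card_insert_le_m1) auto
  also have "card (g ` (*) a ` B) \<le> card B"
    unfolding image_image by (rule card_image_le) simp
  finally have "card ?B \<le> j + 1"
    using B by simp
  moreover have "U' \<subseteq> F4_span ?B"
  proof
    fix x assume "x \<in> U'"
    then obtain y where y: "y \<in> F4_span (g ` (*) a ` B)" "?f y = ?f x"
      using lift[of "?f x"] by (auto simp: U'_def)
    then have "y \<in> F4_span ?B"
      using F4_span_mono[of "g ` (*) a ` B" ?B] by blast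
    moreover have "?f (y + x) = 0"
      by (simp only: f_add y char2_add_self[OF char])
    then have "(y + x) ^ 4 = y + x"
      by (simp only: char2_add_eq_0_iff[OF char])
    ultimately have "y + (y + x) * 1 \<in> F4_span ?B"
      by (intro F4_span.add) auto
    then show "x \<in> F4_span ?B"
      by (simp only: mult_1_right char2_add_self[OF char])
  qed
  moreover have "(\<Sum>x\<in>U'. inverse x) = 0"
    unfolding U'_def
    using sum_inverse_vimage[OF range U1(1) sum_inverse_fiber_quartic[OF char F4]]
    by (simp add: ker sum_U1 sum_inverse_F4[OF char F4])
  moreover have "card U' = 2 ^ (k + 2)"
    using card_vimage_additive[of ?f U1, OF f_add range]
    by (simp only: U'_def ker F4 U1) (simp add: power_add)
  moreover have "0 \<in> U'"
    using U1(1) by (simp add: U'_def)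
  moreover have "\<forall>x\<in>U'. \<forall>y\<in>U'. x + y \<in> U'"
    by (simp only: U'_def vimage_eq f_add Ball_def) (blast intro: U1(2))
  ultimately have "F4_spanned_zero_sum (k + 2) (j + 1) U'"
    unfolding F4_spanned_zero_sum_def by blast
  then show ?thesis ..
qed

lemma F4_spanned_zero_sum_iterate:
  fixes U :: "'a::{field, finite} set"
  assumes "CHAR('a) = 2" and "CARD('a) = 2 ^ (2 * m)"
    and "F4_spanned_zero_sum k j U" and "j + i \<le> m"
  shows "\<exists>U' :: 'a set. F4_spanned_zero_sum (k + 2 * i) (j + i) U'"
  using assms(4)
proof (induction i)
  case (Suc i)
  then obtain U' :: "'a set" where "F4_spanned_zero_sum (k + 2 * i) (j + i) U'"
    by auto
  from F4_spanned_zero_sum_step[OF assms(1,2) this] Suc.prems show ?case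
    by simp
qed (use assms in auto)

section \<open>The three-dimensional start for odd dimensions\<close>

text \<open>
  The map \<open>x \<mapsto> x ^ 2 ^ m + x\<close> has the subfield as its kernel and sends everything into it, so the
  subfield has at least \<open>2 ^ m > 4\<close> elements.
\<close>

lemma exists_fixed_half_frobenius:
  assumes char: "CHAR('a::{field, finite}) = 2" and card: "CARD('a) = 2 ^ (2 * m)" and "3 \<le> m"
  shows "\<exists>t :: 'a. t ^ 2 ^ m = t \<and> t ^ 4 \<noteq> t"
proof (rule ccontr)
  assume contra: "\<not> ?thesis"
  let ?f = "\<lambda>z :: 'a. z ^ 2 ^ m + z" and ?K = "{c :: 'a. c ^ 2 ^ m = c}"
  have ker: "?f -` {0} = ?K"
    by (simp add: vimage_def char2_add_eq_0_iff[OF char])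
  have "(x ^ 2 ^ m) ^ 2 ^ m = x" for x :: 'a
    using finite_field_power_card[of x] by (simp add: card mult_2 power_add power_mult)
  then have "range ?f \<subseteq> ?K"
    by (auto simp: char2_power_add[OF char] add.commute)
  then have le: "card (range ?f) \<le> card ?K"
    by (intro card_mono) auto
  have "card (?f -` range ?f) = card ?K * card (range ?f)"
    unfolding ker[symmetric] by (rule card_vimage_additive) (simp_all add: char2_power_add[OF char])
  moreover have "?f -` range ?f = UNIV" by auto
  ultimately have "2 ^ (2 * m) = card ?K * card (range ?f)"
    by (simp only: card)
  also have "\<dots> \<le> (card ?K)\<^sup>2"
    using le by (simp add: power2_eq_square)
  also have "card ?K \<le> card {c :: 'a. c ^ 4 = c}"
    using contra by (intro card_mono) auto
  also have "\<dots> \<le> 4"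
    by (rule card_fixed_power_le) simp
  finally have "2 ^ (2 * m) \<le> (2 :: nat) ^ 4"
    by simp
  then have "2 * m \<le> 4"
    by (subst (asm) power_increasing_iff) auto
  with \<open>3 \<le> m\<close> show False by simp
qed

text \<open>The conjugates of \<open>c\<close> repeat with period \<open>m\<close>, so each occurs
  twice in the absolute trace, which therefore vanishes.\<close>

lemma fixed_half_frobenius_in_range:
  fixes c :: "'a::{field, finite}"
  assumes char: "CHAR('a) = 2" and card: "CARD('a) = 2 ^ (2 * m)" and "0 < m"
    and c: "c ^ 2 ^ m = c"
  shows "c \<in> range (\<lambda>z. z\<^sup>2 + z)"
proof -
  have split: "(\<Sum>i<m + k. f i) = (\<Sum>i<m. f i) + (\<Sum>i<k. f (m + i))" for k and f :: "nat \<Rightarrow> 'a"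
    by (induction k) (simp_all add: add.assoc)
  have "rel_trace 1 (2 * m) c = (\<Sum>i<m. c ^ 2 ^ i) + (\<Sum>i<m. c ^ 2 ^ (m + i))"
    by (simp only: rel_trace_def mult_2 mult_1 split)
  also have "\<dots> = (\<Sum>i<m. c ^ 2 ^ i) + (\<Sum>i<m. c ^ 2 ^ i)"
    by (simp add: power_add power_mult c)
  also have "\<dots> = 0"
    by (rule char2_add_self[OF char])
  finally show ?thesis
    using range_artin_schreier[OF char, of 1 "2 * m"] card \<open>0 < m\<close> by simp
qed

text \<open>The kernel \<open>{0, 1}\<close> and the subgroup \<open>W\<close> each contribute 1 to
  the sum over the preimage \<open>U\<close>, and \<open>1 + 1 = 0\<close>.\<close>

lemma exists_three_dim_zero_sum:
  assumes char: "CHAR('a::{field, finite}) = 2" and card: "CARD('a) = 2 ^ (2 * m)" and "3 \<le> m"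
  shows "\<exists>U :: 'a set. F4_spanned_zero_sum 3 3 U"
proof -
  let ?f = "\<lambda>z :: 'a. z\<^sup>2 + z"
  note two = char2_add_self[OF char]
  have f_add: "?f (x + y) = ?f x + ?f y" for x y
    using char2_power_add[OF char, of x y 1] by simp
  obtain t :: 'a where t: "t ^ 2 ^ m = t" "t ^ 4 \<noteq> t"
    using exists_fixed_half_frobenius[OF assms] by blast
  then have t01: "t \<noteq> 0" "t \<noteq> 1" by auto
  define d where "d = t\<^sup>2 + t"
  have "t ^ 4 = (t\<^sup>2)\<^sup>2"
    by simp
  \<comment> \<open>This is where \<open>t\<close> outside \<open>F\<^sub>4\<close> enters: it makes
    \<open>d\<close> and \<open>d + 1\<close> nonzero, so \<open>u\<close> is nonzero as
    well.\<close>
  then have "d * (d + 1) = t ^ 4 + t"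
    using f_add[of "t\<^sup>2" t] by (simp add: d_def power2_eq_square algebra_simps two)
  then have d: "d \<noteq> 0" "d + 1 \<noteq> 0"
    using t(2) by (metis char2_add_eq_0_iff[OF char] mult_zero_left, metis char2_add_eq_0_iff[OF char] mult_zero_right)
  \<comment> \<open>The inverses over \<open>W\<close> sum to \<open>inverse u * (1 + inverse t +
    inverse (t + 1)) = inverse u * (1 + inverse d)\<close>; this \<open>u\<close> makes that
    1.\<close>
  define u where "u = 1 + inverse d"
  define v where "v = t * u"
  have "u = (d + 1) / d"
    using d by (simp add: u_def field_simps)
  with d have "u \<noteq> 0" by simp
  have K: "d ^ 2 ^ m = d" "u ^ 2 ^ m = u" "v ^ 2 ^ m = v"
  proof -
    have "(t\<^sup>2) ^ 2 ^ m = (t ^ 2 ^ m)\<^sup>2"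
      by (metis power_mult mult.commute)
    then show "d ^ 2 ^ m = d"
      by (simp only: d_def char2_power_add[OF char] t(1))
    then show "u ^ 2 ^ m = u"
      by (simp add: u_def char2_power_add[OF char] power_inverse)
    then show "v ^ 2 ^ m = v"
      by (simp add: v_def power_mult_distrib t)
  qed
  obtain x y where x: "u = ?f x" and y: "v = ?f y"
    using fixed_half_frobenius_in_range[OF char card] K \<open>3 \<le> m\<close> by (metis (no_types, lifting) gr0I imageE not_numeral_le_zero)
  define W where "W = {0, u, v, u + v}"
  define U where "U = ?f -` W"
  have ne: "u \<noteq> 0" "v \<noteq> 0" "u \<noteq> v" "u + v \<noteq> 0" "u + v \<noteq> u" "u + v \<noteq> v"
    using \<open>u \<noteq> 0\<close> t01 by (auto simp: v_def char2_add_eq_0_iff[OF char])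
  have W: "card W = 4"
    using ne by (auto simp: W_def)
  have ker: "?f -` {0} = {0, 1}"
    using char2_quadratic_eq_iff[OF char, of _ 0] by auto
  have range: "W \<subseteq> range ?f"
    by (auto simp: W_def x y f_add[symmetric] intro: image_eqI[where x = 0])
  have "(\<Sum>w\<in>W. inverse w) = inverse u + (inverse v + inverse (u + v))"
    using ne by (simp add: W_def)
  also have "u + v = u * (t + 1)"
    by (simp add: v_def algebra_simps)
  also have "inverse u + (inverse v + inverse (u * (t + 1)))
      = inverse u * (1 + (inverse t + inverse (t + 1)))"
    by (simp only: v_def inverse_mult_distrib) (simp add: algebra_simps)
  also have "inverse t + inverse (t + 1) = inverse d"
    using char2_inverse_add_1[OF char, of t] d by (simp add: d_def)
  also have "inverse u * (1 + inverse d) = 1"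
    using \<open>u \<noteq> 0\<close> by (simp add: u_def)
  finally have "(\<Sum>z\<in>U. inverse z) = 1 + 1"
    unfolding U_def using sum_inverse_vimage[OF range _ sum_inverse_fiber_quadratic[OF char]]
    by (simp add: ker W_def)
  then have "(\<Sum>z\<in>U. inverse z) = 0"
    by (simp only: two)
  moreover have "card U = 2 ^ 3"
    using card_vimage_additive[of ?f W, OF f_add range] by (simp add: U_def ker W)
  moreover have "0 \<in> U"
    by (simp add: U_def W_def)
  moreover have "\<forall>z\<in>U. \<forall>z'\<in>U. z + z' \<in> U"
  proof -
    have "\<forall>w\<in>W. \<forall>w'\<in>W. w + w' \<in> W"
      using two(2)[of v u] by (auto simp: W_def two ac_simps)
    then show ?thesis
      by (simp only: U_def vimage_eq f_add) blast
  qed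
  moreover have "card {1, x, y} \<le> 3"
    by (auto simp: card_insert_if)
  moreover have "U \<subseteq> F4_span {1, x, y}"
  proof
    fix z assume "z \<in> U"
    have add: "a + b \<in> F4_span {1, x, y}" if "a \<in> F4_span {1, x, y}" "b \<in> {1, x, y}" for a b
      using F4_span.add[OF that, of 1] by simp
    have "?f z \<in> ?f ` {0, x, y, x + y}"
      using \<open>z \<in> U\<close> by (simp add: U_def W_def x y f_add del: f_add[symmetric])
    then obtain w where w: "w \<in> {0, x, y, x + y}" "?f z = ?f w"
      by blast
    have "w \<in> F4_span {1, x, y}"
      using w(1) add[OF F4_span.zero, of x] add[OF F4_span.zero, of y] add[of x y]
      by (auto intro: F4_span.zero)
    with w(2) add show "z \<in> F4_span {1, x, y}"
      by (auto simp: char2_quadratic_eq_iff[OF char])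
  qed
  ultimately have "F4_spanned_zero_sum 3 3 U"
    unfolding F4_spanned_zero_sum_def by blast
  then show ?thesis ..
qed

theorem theorem5p2:
  fixes n k :: nat
  assumes "CARD('a::{field, finite}) = 2 ^ n"
    and "even n" and "n > 0"
    and "2 \<le> k" and "k \<le> n - 2"
  shows "\<not> kth_order_sum_free k (F_inv n :: 'a \<Rightarrow> 'a)"
proof -
  obtain m where m: "n = 2 * m"
    using \<open>even n\<close> by blast
  note card = assms(1)[unfolded m]
  have "prime CHAR('a)"
    by (intro prime_CHAR_semidom finite_imp_CHAR_pos) simp
  moreover have "CHAR('a) dvd 2 ^ n"
    using CHAR_dvd_CARD[where 'a = 'a] assms(1) by simp
  ultimately have char: "CHAR('a) = 2"
    by (metis prime_dvd_power primes_dvd_imp_eq two_is_prime_nat)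
  have "\<exists>j. \<exists>U :: 'a set. F4_spanned_zero_sum k j U"
  proof (cases "even k")
    case True
    then obtain i where "k = 2 * i" by blast
    moreover have "F4_spanned_zero_sum 0 0 {0 :: 'a}"
      by (auto simp: F4_spanned_zero_sum_def intro: F4_span.zero exI[of _ "{}"])
    ultimately show ?thesis
      using F4_spanned_zero_sum_iterate[OF char card, of 0 0 _ i] assms m by fastforce
  next
    case False
    then obtain i where i: "k = 2 * i + 1" by (rule oddE)
    \<comment> \<open>Since \<open>k\<close> is odd and \<open>n\<close> even,
      \<open>k <= n - 2\<close> improves to \<open>k <= n - 3\<close>, which is exactly the room
      needed for a start with three generators.\<close>
    then have k: "k = 3 + 2 * (i - 1)" "3 + (i - 1) \<le> m"
      using assms m by presburger+
    then obtain U :: "'a set" where "F4_spanned_zero_sum 3 3 U"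
      using exists_three_dim_zero_sum[OF char card] by auto
    from F4_spanned_zero_sum_iterate[OF char card this k(2)] show ?thesis
      unfolding k(1) by blast
  qed
  then show ?thesis
    using not_sum_free_of_zero_sum[OF assms(1)] assms
    by (auto simp: F4_spanned_zero_sum_def)
qed

end
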